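(* Let $K$ be a compact space. Then $K$ is semi-Eberlein if and only if there exist a dense set $D\subseteq K$, a cardinal $\kappa$, and a subset $L\subseteq C(K)$ such that $L$, with the subspace topology inherited from $\langle C(K),\tau_p(D)\rangle$, is homeomorphic to $A(\kappa)$, and $L$ separates the points of $K$ (i.e. for every two distinct $x,y\in K$ there is $f\in L$ with $f(x)\neq f(y)$).
   Context: All spaces are completely regular (Hausdorff). For a set $S$, $c_0(S)$ is the set of all $x\in\mathbb{R}^S$ such that for every $\varepsilon>0$ the set $\{s\in S : |x(s)|>\varepsilon\}$ is finite; $\mathbb{R}^S$ carries the product topology. A compact space $K$ is semi-Eberlein if for some set $S$ there is a topological embedding of $K$ into $\mathbb{R}^S$ such that, identifying $K$ with its image, $c_0(S)\cap K$ is dense in $K$. $A(\kappa)$ denotes the one-point compactification of the discrete space of size $\kappa$ (the discrete space together with one additional point). $C(K)$ is the set of continuous real-valued functions on $K$, and for a dense set $D\subseteq K$, $\tau_p(D)$ is the topology on $C(K)$ of pointwise convergence on $D$. *)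

theory Defs
  imports "HOL-Analysis.Analysis"
begin

definition dense_in :: "'a topology \<Rightarrow> 'a set \<Rightarrow> bool" where
  "dense_in X D \<longleftrightarrow> D \<subseteq> topspace X \<and> X closure_of D = topspace X"

text \<open>As in \<^term>\<open>powertop_real S\<close>, the elements of $R^S$ are functions that are
  \<^term>\<open>undefined\<close> outside \<^term>\<open>S\<close>.\<close>

definition c0 :: "'s set \<Rightarrow> ('s \<Rightarrow> real) set" where
  "c0 S = {x \<in> topspace (powertop_real S). \<forall>\<epsilon>>0. finite {s \<in> S. \<bar>x s\<bar> > \<epsilon>}}"

definition semi_Eberlein_embedding ::
    "'a topology \<Rightarrow> 's set \<Rightarrow> ('a \<Rightarrow> 's \<Rightarrow> real) \<Rightarrow> bool" where
  "semi_Eberlein_embedding K S e \<longleftrightarrow>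
     embedding_map K (powertop_real S) e \<and>
     dense_in (subtopology (powertop_real S) (e ` topspace K)) (c0 S \<inter> e ` topspace K)"

text \<open>HOL cannot quantify over sets of arbitrary type, so the index set \<^term>\<open>S\<close> is taken
  from the type \<^typ>\<open>'a \<Rightarrow> real\<close>. Nothing is lost: see \<open>semi_EberleinI\<close> below.\<close>

definition semi_Eberlein :: "'a topology \<Rightarrow> bool" where
  "semi_Eberlein K \<longleftrightarrow>
     compact_space K \<and> (\<exists>(S :: ('a \<Rightarrow> real) set) e. semi_Eberlein_embedding K S e)"

text \<open>Cardinals are represented by well-orders as in the library's cardinal theory; the field of
  \<open>\<kappa>\<close> is then a set of size \<open>\<kappa>\<close>. For finite \<open>\<kappa>\<close> the added point is isolated.\<close>

definition one_point_A :: "'k rel \<Rightarrow> 'k option topology" where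
  "one_point_A \<kappa> = Alexandroff_compactification (discrete_topology (Field \<kappa>))"

text \<open>Extensionality makes each continuous function on \<^term>\<open>topspace K\<close> have exactly one
  representative.\<close>

definition C_fun :: "'a topology \<Rightarrow> ('a \<Rightarrow> real) set" where
  "C_fun K = {f \<in> extensional (topspace K). continuous_map K euclideanreal f}"

definition tau_p :: "'a topology \<Rightarrow> 'a set \<Rightarrow> ('a \<Rightarrow> real) topology" where
  "tau_p K D = pullback_topology (C_fun K) (\<lambda>f. restrict f D) (powertop_real D)"

definition separates_points :: "('a \<Rightarrow> real) set \<Rightarrow> 'a topology \<Rightarrow> bool" where
  "separates_points L K \<longleftrightarrow>
     (\<forall>x\<in>topspace K. \<forall>y\<in>topspace K. x \<noteq> y \<longrightarrow> (\<exists>f\<in>L. f x \<noteq> f y))"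


text \<open>The choice of index type in \<^const>\<open>semi_Eberlein\<close> is immaterial: coordinates that agree
  on \<^term>\<open>K\<close> can be merged, so the index set embeds into the functions on \<^term>\<open>K\<close>.\<close>

lemma semi_EberleinI:
  fixes K :: "'a topology" and S :: "'s set"
  assumes K: "compact_space K" and e: "semi_Eberlein_embedding K S e"
  shows "semi_Eberlein K"
proof -
  define \<phi> where "\<phi> s = restrict (\<lambda>x. e x s) (topspace K)" for s
  define T where "T = \<phi> ` S"
  define r where "r t = (SOME s. s \<in> S \<and> \<phi> s = t)" for t
  have r: "r t \<in> S \<and> \<phi> (r t) = t" if "t \<in> T" for t
    using that unfolding T_def r_def by (auto intro: someI2)
  define g where "g y = restrict (\<lambda>t. y (r t)) T" for y :: "'s \<Rightarrow> real"
  define e' where "e' x = g (e x)" for x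
  let ?RS = "powertop_real S" and ?RT = "powertop_real T"
  have emb: "embedding_map K ?RS e"
    and dens: "dense_in (subtopology ?RS (e ` topspace K)) (c0 S \<inter> e ` topspace K)"
    using e by (auto simp: semi_Eberlein_embedding_def)
  have conte: "continuous_map K ?RS e"
    using emb homeomorphic_imp_continuous_map continuous_map_in_subtopology
    unfolding embedding_map_def by blast
  have eS: "e x \<in> topspace ?RS" if "x \<in> topspace K" for x
    using conte that continuous_map_image_subset_topspace by blast
  have inje: "inj_on e (topspace K)"
    using emb by (auto simp: embedding_map_def homeomorphic_map_def quotient_map_def)
  have contg: "continuous_map ?RS ?RT g"
    unfolding continuous_map_componentwise
  proof (intro conjI ballI)
    show "g ` topspace ?RS \<subseteq> extensional T"
      by (auto simp: g_def)
    fix t assume t: "t \<in> T"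
    have "continuous_map ?RS euclideanreal (\<lambda>y. y (r t))"
      using r[OF t] by (intro continuous_map_product_projection) auto
    then show "continuous_map ?RS euclideanreal (\<lambda>x. g x t)"
      using t by (simp add: g_def)
  qed
  have conte': "continuous_map K ?RT e'"
    using continuous_map_compose[OF conte contg] by (simp add: o_def e'_def[abs_def])
  have inj: "inj_on e' (topspace K)"
  proof (rule inj_onI)
    fix x y assume xy: "x \<in> topspace K" "y \<in> topspace K" "e' x = e' y"
    have "e x s = e y s" if s: "s \<in> S" for s
    proof -
      have t: "\<phi> s \<in> T" using s by (auto simp: T_def)
      have "e z (r (\<phi> s)) = e z s" if "z \<in> topspace K" for z
        using r[OF t] that unfolding \<phi>_def by (metis (no_types, lifting) restrict_apply')
      moreover have "e x (r (\<phi> s)) = e y (r (\<phi> s))"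
        using fun_cong[OF xy(3), of "\<phi> s"] t by (simp add: e'_def g_def)
      ultimately show ?thesis using xy by simp
    qed
    moreover have "e x \<in> extensional S" "e y \<in> extensional S"
      using eS xy by (auto simp: PiE_def)
    ultimately have "e x = e y" by (meson extensionalityI)
    then show "x = y" using inje xy by (auto dest: inj_onD)
  qed
  have "Hausdorff_space ?RT"
    by (simp add: Hausdorff_space_product_topology)
  then have "closed_map K ?RT e'"
    using K conte' by (intro continuous_imp_closed_map_gen) (auto simp: Hausdorff_imp_kc_space)
  then have emb': "embedding_map K ?RT e'"
    using conte' inj injective_closed_imp_embedding_map by blast
  have r_inj: "inj_on r T"
    using r by (metis inj_onI)
  have gc0: "g y \<in> c0 T" if y: "y \<in> c0 S" for y
  proof -
    have "finite {t \<in> T. \<bar>g y t\<bar> > \<epsilon>}" if "\<epsilon> > 0" for \<epsilon>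
    proof (rule finite_imageD)
      have "r ` {t \<in> T. \<bar>g y t\<bar> > \<epsilon>} \<subseteq> {s \<in> S. \<bar>y s\<bar> > \<epsilon>}"
        using r by (auto simp: g_def)
      moreover have "finite {s \<in> S. \<bar>y s\<bar> > \<epsilon>}"
        using y that by (auto simp: c0_def)
      ultimately show "finite (r ` {t \<in> T. \<bar>g y t\<bar> > \<epsilon>})"
        by (rule finite_subset)
      show "inj_on r {t \<in> T. \<bar>g y t\<bar> > \<epsilon>}"
        using r_inj by (auto intro: inj_on_subset)
    qed
    then show ?thesis by (auto simp: c0_def g_def)
  qed
  have img: "g ` (e ` topspace K) = e' ` topspace K"
    by (auto simp: e'_def)
  have sub: "e' ` topspace K \<subseteq> topspace ?RT" 
    using conte' continuous_map_image_subset_topspace by blast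
  have subS: "e ` topspace K \<subseteq> topspace ?RS" 
    using eS by blast
  let ?D = "c0 S \<inter> e ` topspace K" and ?D' = "c0 T \<inter> e' ` topspace K"
  have cl: "e ` topspace K \<subseteq> ?RS closure_of ?D"
  proof -
    have "subtopology ?RS (e ` topspace K) closure_of ?D = e ` topspace K"
      using dens subS by (auto simp: dense_in_def)
    then show ?thesis
      by (metis closure_of_subtopology_subset)
  qed
  have "e' ` topspace K \<subseteq> g ` (?RS closure_of ?D)"
    using cl img by blast
  also have "\<dots> \<subseteq> ?RT closure_of (g ` ?D)"
    using contg by (rule continuous_map_image_closure_subset)
  also have "\<dots> \<subseteq> ?RT closure_of ?D'"
    using gc0 img by (intro closure_of_mono) blast
  finally have "subtopology ?RT (e' ` topspace K) closure_of ?D' = e' ` topspace K"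
    by (subst closure_of_subtopology) (auto simp: Int_absorb1)
  then have "dense_in (subtopology ?RT (e' ` topspace K)) ?D'"
    using sub by (auto simp: dense_in_def)
  then show ?thesis
    using K emb' unfolding semi_Eberlein_def semi_Eberlein_embedding_def by blast
qed

text \<open>Likewise, a copy of \<^term>\<open>one_point_A \<kappa>\<close> inside a set of real functions forces \<open>\<kappa>\<close> to be
  equipotent to a cardinal on the function type itself.\<close>

lemma openin_one_point_A:
  "openin (one_point_A \<kappa>) V \<longleftrightarrow>
     V \<subseteq> insert None (Some ` Field \<kappa>) \<and>
     (None \<in> V \<longrightarrow> finite {a \<in> Field \<kappa>. Some a \<notin> V})"
  (is "?l \<longleftrightarrow> ?r")
proof
  assume ?l
  then show ?r
    by (auto simp: one_point_A_def openin_Alexandroff_compactification compactin_discrete_topology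
        elim: finite_subset[rotated])
next
  assume r: ?r
  show ?l
  proof (cases "None \<in> V")
    case True
    let ?C = "{a \<in> Field \<kappa>. Some a \<notin> V}"
    have "V = insert None (Some ` (Field \<kappa> - ?C))"
      using True r by auto
    then show ?thesis
      using True r unfolding one_point_A_def openin_Alexandroff_compactification
      by (intro disjI2 exI[of _ ?C]) (auto simp: compactin_discrete_topology)
  next
    case False
    then have "V = Some ` {a. Some a \<in> V}" "{a. Some a \<in> V} \<subseteq> Field \<kappa>"
      using r by (auto simp: image_iff)
    then show ?thesis
      unfolding one_point_A_def openin_Alexandroff_compactification by auto
  qed
qed

lemma one_point_A_homeomorphic:
  assumes "bij_betw h (Field \<kappa>) (Field \<mu>)"
  shows "one_point_A \<kappa> homeomorphic_space one_point_A \<mu>"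
proof -
  let ?k = "the_inv_into (Field \<kappa>) h"
  have k: "bij_betw ?k (Field \<mu>) (Field \<kappa>)"
    using assms by (rule bij_betw_the_inv_into)
  have cont: "continuous_map (one_point_A \<alpha>) (one_point_A \<beta>) (map_option f)"
    if f: "bij_betw f (Field \<alpha>) (Field \<beta>)" for f :: "'x \<Rightarrow> 'y" and \<alpha> \<beta>
  proof -
    have top: "topspace (one_point_A \<gamma>) = insert None (Some ` Field \<gamma>)" for \<gamma> :: "'z rel"
      by (simp add: one_point_A_def)
    have fin: "finite {a \<in> Field \<alpha>. Some (f a) \<notin> V}"
      if "finite {b \<in> Field \<beta>. Some b \<notin> V}" for V
    proof (rule finite_imageD[of f])
      show "finite (f ` {a \<in> Field \<alpha>. Some (f a) \<notin> V})"
        using f by (intro finite_subset[OF _ that]) (auto simp: bij_betw_def)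
      show "inj_on f {a \<in> Field \<alpha>. Some (f a) \<notin> V}"
        using f by (auto simp: bij_betw_def intro: inj_on_subset)
    qed
    show ?thesis
      unfolding continuous_map_def
    proof (intro conjI allI impI)
      show "map_option f \<in> topspace (one_point_A \<alpha>) \<rightarrow> topspace (one_point_A \<beta>)"
        using f by (auto simp: one_point_A_def bij_betw_def)
      fix V assume V: "openin (one_point_A \<beta>) V"
      have "{a \<in> Field \<alpha>. Some a \<notin> {x \<in> topspace (one_point_A \<alpha>). map_option f x \<in> V}}
          = {a \<in> Field \<alpha>. Some (f a) \<notin> V}"
        by (auto simp: one_point_A_def)
      then show "openin (one_point_A \<alpha>) {x \<in> topspace (one_point_A \<alpha>). map_option f x \<in> V}"
        using V fin by (auto simp: openin_one_point_A) (auto simp: one_point_A_def)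
    qed
  qed
  have "homeomorphic_maps (one_point_A \<kappa>) (one_point_A \<mu>) (map_option h) (map_option ?k)"
    unfolding homeomorphic_maps_def
    using cont[OF assms] cont[OF k] assms
    by (auto simp: one_point_A_def bij_betw_def the_inv_into_f_f f_the_inv_into_f)
  then show ?thesis
    using homeomorphic_space_def by blast
qed

lemma one_point_A_cardinal_type:
  fixes \<kappa> :: "'k rel" and X :: "'b topology"
  assumes "X homeomorphic_space one_point_A \<kappa>"
  shows "\<exists>\<mu> :: 'b rel. Card_order \<mu> \<and> X homeomorphic_space one_point_A \<mu>"
proof -
  obtain h where "homeomorphic_map (one_point_A \<kappa>) X h"
    using assms homeomorphic_space homeomorphic_space_sym by blast
  then have "inj_on h (insert None (Some ` Field \<kappa>))"
    by (auto simp: homeomorphic_map_def one_point_A_def)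
  then have inj: "inj_on (h \<circ> Some) (Field \<kappa>)"
    by (auto simp: inj_on_def)
  define \<mu> where "\<mu> = card_of ((h \<circ> Some) ` Field \<kappa>)"
  have "bij_betw (h \<circ> Some) (Field \<kappa>) (Field \<mu>)"
    unfolding \<mu>_def using inj by (simp only: Field_card_of) (rule inj_on_imp_bij_betw)
  then have "X homeomorphic_space one_point_A \<mu>"
    using assms one_point_A_homeomorphic homeomorphic_space_trans by blast
  then show ?thesis
    unfolding \<mu>_def using card_of_Card_order by blast
qed

end

theory Submission
  imports Defs
begin

text \<open>Up to homeomorphism, \<open>A(\<kappa>)\<close> is a Hausdorff space with a point \<open>p\<close> all of whose
  neighbourhoods are cofinite.  For a set \<open>L\<close> of functions with the topology of pointwise
  convergence on \<open>D\<close>, the neighbourhoods of \<open>p \<in> L\<close> are cofinite iff the family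
  \<open>(f - p)\<^bsub>f \<in> L\<^esub>\<close> evaluates into \<open>c\<^sub>0(L)\<close> at every \<open>d \<in> D\<close>.  Given an
  embedding of \<open>K\<close>, take for \<open>L\<close> the coordinate functions together with \<open>p = 0\<close>.  Conversely,
  map \<open>x\<close> to \<open>(f(x) - p(x))\<^bsub>f \<in> L\<^esub>\<close>, except that the coordinate \<open>f = p\<close> is \<open>p(x)\<close> itself:
  this does not affect membership in \<open>c\<^sub>0\<close>, and the map remains injective when it
  is \<open>p\<close> that separates two points.\<close>

section \<open>Topological characterization of \<open>A(\<kappa>)\<close>\<close>

text \<open>Hausdorff separation isolates every \<open>x \<noteq> p\<close>: a neighbourhood of
  \<open>x\<close> disjoint from a neighbourhood of \<open>p\<close> is finite, and finite sets are
  closed. So the open sets are exactly the sets missing \<open>p\<close> and the cofinite ones, as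
  in the one-point compactification of a discrete space.\<close>

lemma homeomorphic_space_one_point_A:
  assumes X: "Hausdorff_space X" and p: "p \<in> topspace X"
    and cofin: "\<And>V. openin X V \<Longrightarrow> p \<in> V \<Longrightarrow> finite (topspace X - V)"
  shows "X homeomorphic_space one_point_A (card_of (topspace X - {p}))"
proof -
  let ?\<kappa> = "card_of (topspace X - {p})"
  let ?A = "one_point_A ?\<kappa>"
  \<comment> \<open>The added point \<open>None\<close> goes to \<open>p\<close>, and
    \<open>Some x\<close> to \<open>x\<close>.\<close>
  define h where "h = case_option p id"
  have top: "topspace ?A = insert None (Some ` (topspace X - {p}))"
    by (simp add: one_point_A_def Field_card_of)
  have isolated: "openin X {x}" if x: "x \<in> topspace X" "x \<noteq> p" for x
  proof -
    obtain U V where UV: "openin X U" "openin X V" "p \<in> U" "x \<in> V" "disjnt U V"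
      using X x p unfolding Hausdorff_space_def by metis
    have "V \<subseteq> topspace X - U"
      using UV openin_subset by (fastforce simp: disjnt_def)
    then have "finite V"
      using cofin[OF UV(1,3)] finite_subset by blast
    moreover have "V - {x} \<subseteq> topspace X"
      using openin_subset[OF UV(2)] by blast
    ultimately have "closedin X (V - {x})"
      using X closedin_Hausdorff_finite by blast
    \<comment> \<open>Removing the finite closed set \<open>V - {x}\<close> from the open set
      \<open>V\<close> leaves only \<open>x\<close>.\<close>
    then have "openin X (V - (V - {x}))"
      using UV(2) by blast
    moreover have "V - (V - {x}) = {x}"
      using UV(4) by blast
    ultimately show ?thesis by simp
  qed
  have opn: "openin X V" if "V \<subseteq> topspace X" "p \<notin> V" for V
    using that isolated openin_Union[of "(\<lambda>x. {x}) ` V" X] by fastforce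
  have opnp: "openin X V" if "V \<subseteq> topspace X" "finite (topspace X - V)" for V
  proof -
    have "closedin X (topspace X - V)"
      using X that(2) by (intro closedin_Hausdorff_finite) auto
    then show ?thesis
      using that(1) openin_closedin_eq by blast
  qed
  have inj: "inj_on h (topspace ?A)"
    by (auto simp: top h_def inj_on_def)
  have surj: "h ` topspace ?A = topspace X"
    using p by (force simp: top h_def)
  have cont: "continuous_map ?A X h"
    unfolding continuous_map_def
  proof (intro conjI allI impI)
    show "h \<in> topspace ?A \<rightarrow> topspace X"
      using surj by blast
    fix V assume V: "openin X V"
    have "finite {a \<in> topspace X - {p}. a \<notin> V}" if "p \<in> V"
      using cofin[OF V that] by (rule finite_subset[rotated]) auto
    moreover have "{a \<in> Field ?\<kappa>. Some a \<notin> {x \<in> topspace ?A. h x \<in> V}}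
        = {a \<in> topspace X - {p}. a \<notin> V}"
      by (auto simp: top h_def Field_card_of)
    ultimately show "openin ?A {x \<in> topspace ?A. h x \<in> V}"
      unfolding openin_one_point_A by (auto simp: top Field_card_of h_def)
  qed
  have "open_map ?A X h"
    unfolding open_map_def
  proof (intro allI impI)
    fix V assume V: "openin ?A V"
    have sub: "V \<subseteq> topspace ?A"
      using V by (rule openin_subset)
    have hsub: "h ` V \<subseteq> topspace X"
      using sub surj by blast
    show "openin X (h ` V)"
    proof (cases "None \<in> V")
      case True
      then have "finite {a \<in> topspace X - {p}. Some a \<notin> V}"
        using V by (simp add: openin_one_point_A Field_card_of)
      moreover have "topspace X - h ` V \<subseteq> {a \<in> topspace X - {p}. Some a \<notin> V}"
        using True by (force simp: h_def)
      ultimately show ?thesis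
        using opnp hsub finite_subset by blast
    next
      case False
      then have "p \<notin> h ` V"
        using sub by (auto simp: top h_def)
      then show ?thesis
        using opn hsub by blast
    qed
  qed
  then have "homeomorphic_map ?A X h"
    using cont inj surj bijective_open_imp_homeomorphic_map by blast
  then show ?thesis
    using homeomorphic_map_imp_homeomorphic_space homeomorphic_space_sym by blast
qed

text \<open>The point \<open>p\<close> is the image of the added point \<open>None\<close>; its
  neighbourhoods pull back to neighbourhoods of \<open>None\<close>, which are cofinite.\<close>

lemma homeomorphic_one_point_A_imp_cofinite:
  assumes "X homeomorphic_space one_point_A \<kappa>"
  obtains p where "p \<in> topspace X"
    and "\<And>V. openin X V \<Longrightarrow> p \<in> V \<Longrightarrow> finite (topspace X - V)"
proof -
  have top: "topspace (one_point_A \<kappa>) = insert None (Some ` Field \<kappa>)"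
    by (simp add: one_point_A_def)
  obtain h where h: "homeomorphic_map (one_point_A \<kappa>) X h"
    using assms homeomorphic_space homeomorphic_space_sym by blast
  have surj: "h ` topspace (one_point_A \<kappa>) = topspace X"
    using h by (rule homeomorphic_imp_surjective_map)
  show thesis
  proof
    show "h None \<in> topspace X"
      using surj top by auto
    fix V assume V: "openin X V" "h None \<in> V"
    let ?W = "{x \<in> topspace (one_point_A \<kappa>). h x \<in> V}"
    have "openin (one_point_A \<kappa>) ?W"
      using h V(1) by (intro openin_continuous_map_preimage)
        (auto intro: homeomorphic_imp_continuous_map)
    then have "finite {a \<in> Field \<kappa>. Some a \<notin> ?W}"
      using V(2) top by (simp add: openin_one_point_A)
    moreover have "topspace X - V \<subseteq> (h \<circ> Some) ` {a \<in> Field \<kappa>. Some a \<notin> ?W}"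
      using V(2) by (auto simp: surj[symmetric] top)
    ultimately show "finite (topspace X - V)"
      using finite_surj by blast
  qed
qed

section \<open>Pointwise convergence on \<open>D\<close>\<close>

lemma topspace_tau_p [simp]: "topspace (tau_p K D) = C_fun K"
  by (auto simp: tau_p_def topspace_pullback_topology)

lemma continuous_map_tau_p_restrict:
  "continuous_map (tau_p K D) (powertop_real D) (\<lambda>f. restrict f D)"
  unfolding tau_p_def
  using continuous_map_pullback[OF continuous_map_id] by (simp add: o_def)

lemma continuous_map_tau_p_eval:
  assumes "d \<in> D"
  shows "continuous_map (tau_p K D) euclideanreal (\<lambda>f. f d)"
  using continuous_map_tau_p_restrict[of K D] assms
  unfolding continuous_map_componentwise by simp

lemma C_fun_eqI:
  assumes "f \<in> C_fun K" "g \<in> C_fun K" "dense_in K D" "\<And>d. d \<in> D \<Longrightarrow> f d = g d"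
  shows "f = g"
proof (rule extensionalityI)
  show "f \<in> extensional (topspace K)" "g \<in> extensional (topspace K)"
    using assms by (auto simp: C_fun_def)
  fix x assume "x \<in> topspace K"
  then have "x \<in> K closure_of D"
    using assms by (simp add: dense_in_def)
  then show "f x = g x"
    using assms by (intro forall_in_closure_of_eq[of x K D euclideanreal f g]) (auto simp: C_fun_def)
qed

text \<open>Density makes restriction to \<open>D\<close> injective on \<open>C(K)\<close>, so
  \<open>tau_p K D\<close> maps continuously and injectively into the Hausdorff space
  \<open>powertop_real D\<close>.\<close>

lemma Hausdorff_space_tau_p:
  assumes "dense_in K D"
  shows "Hausdorff_space (tau_p K D)"
proof (rule Hausdorff_space_injective_preimage)
  show "Hausdorff_space (powertop_real D)"
    by (simp add: Hausdorff_space_product_topology)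
  show "inj_on (\<lambda>f. restrict f D) (topspace (tau_p K D))"
  proof (rule inj_onI)
    fix f g assume fg: "f \<in> topspace (tau_p K D)" "g \<in> topspace (tau_p K D)"
      and eq: "restrict f D = restrict g D"
    have "f d = g d" if "d \<in> D" for d
      using fun_cong[OF eq, of d] that by simp
    then show "f = g"
      using fg assms by (intro C_fun_eqI[of f K g D]) simp_all
  qed
qed (rule continuous_map_tau_p_restrict)

text \<open>A basic neighbourhood of \<open>p\<close> restricts values at finitely many points of
  \<open>D\<close>, and a finite union of finite sets is finite. Hence cofiniteness can be tested on
  neighbourhoods that restrict the value at a single \<open>d\<close>.\<close>

lemma tau_p_cofinite_iff:
  assumes L: "L \<subseteq> C_fun K" and p: "p \<in> L"
  shows "(\<forall>V. openin (subtopology (tau_p K D) L) V \<and> p \<in> V \<longrightarrow> finite (L - V))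
    \<longleftrightarrow> (\<forall>d\<in>D. \<forall>\<epsilon>>0. finite {f \<in> L. \<bar>f d - p d\<bar> > \<epsilon>})"
    (is "?l \<longleftrightarrow> ?r")
proof
  assume l: ?l
  show ?r
  proof (intro ballI allI impI)
    fix d and \<epsilon> :: real assume d: "d \<in> D" and \<epsilon>: "\<epsilon> > 0"
    have "continuous_map (subtopology (tau_p K D) L) euclideanreal (\<lambda>f. f d)"
      using continuous_map_tau_p_eval[OF d] by (rule continuous_map_from_subtopology)
    then have "openin (subtopology (tau_p K D) L)
        {f \<in> topspace (subtopology (tau_p K D) L). f d \<in> ball (p d) \<epsilon>}"
      by (rule openin_continuous_map_preimage) simp
    then have "openin (subtopology (tau_p K D) L) {f \<in> L. f d \<in> ball (p d) \<epsilon>}"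
      using L by (simp add: Int_absorb1)
    then have "finite (L - {f \<in> L. f d \<in> ball (p d) \<epsilon>})"
      using l p \<epsilon> by simp
    then show "finite {f \<in> L. \<bar>f d - p d\<bar> > \<epsilon>}"
      by (rule finite_subset[rotated]) (auto simp: dist_real_def)
  qed
next
  assume r: ?r
  show ?l
  proof (intro allI impI, elim conjE)
    fix V assume V: "openin (subtopology (tau_p K D) L) V" and pV: "p \<in> V"
    obtain U where U: "openin (powertop_real D) U" "V = (\<lambda>f. restrict f D) -` U \<inter> C_fun K \<inter> L"
      using V by (auto simp: openin_subtopology tau_p_def openin_pullback_topology)
    then have "restrict p D \<in> U"
      using pV by blast
    then obtain W where W: "finite {d \<in> D. W d \<noteq> UNIV}" "\<forall>d\<in>D. open (W d)"
        "restrict p D \<in> Pi\<^sub>E D W" "Pi\<^sub>E D W \<subseteq> U"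
      using U(1) unfolding openin_product_topology_alt by auto
    have "finite {f \<in> L. f d \<notin> W d}" if d: "d \<in> D" for d
    proof -
      have "open (W d)" "p d \<in> W d"
        using W d by (auto simp: PiE_iff)
      then obtain \<epsilon> where \<epsilon>: "\<epsilon> > 0" "ball (p d) \<epsilon> \<subseteq> W d"
        using open_contains_ball by blast
      \<comment> \<open>Lying outside the open ball only gives distance at least
        \<open>\<epsilon>\<close>, while the hypothesis concerns strict inequality; halving the
        radius closes the gap.\<close>
      have "finite {f \<in> L. \<bar>f d - p d\<bar> > \<epsilon> / 2}"
        using r d half_gt_zero[OF \<epsilon>(1)] by blast
      moreover have "{f \<in> L. f d \<notin> W d} \<subseteq> {f \<in> L. \<bar>f d - p d\<bar> > \<epsilon> / 2}"
      proof clarify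
        fix f assume "f d \<notin> W d"
        then have "f d \<notin> ball (p d) \<epsilon>"
          using \<epsilon>(2) by blast
        then show "\<bar>f d - p d\<bar> > \<epsilon> / 2"
          using \<epsilon>(1) by (simp add: dist_real_def abs_minus_commute)
      qed
      ultimately show ?thesis
        by (rule finite_subset[rotated])
    qed
    then have "finite (\<Union>d\<in>{d \<in> D. W d \<noteq> UNIV}. {f \<in> L. f d \<notin> W d})"
      using W(1) by auto
    \<comment> \<open>A point \<open>d\<close> with \<open>W d = UNIV\<close> excludes no function,
      so the finitely many other points account for all of \<open>L - V\<close>.\<close>
    moreover have "L - V \<subseteq> (\<Union>d\<in>{d \<in> D. W d \<noteq> UNIV}. {f \<in> L. f d \<notin> W d})"
    proof
      fix f assume f: "f \<in> L - V"
      then have "restrict f D \<notin> Pi\<^sub>E D W"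
        using U(2) W(4) L by blast
      then obtain d where "d \<in> D" "f d \<notin> W d"
        by (auto simp: PiE_iff)
      then show "f \<in> (\<Union>d\<in>{d \<in> D. W d \<noteq> UNIV}. {f \<in> L. f d \<notin> W d})"
        using f by auto
    qed
    ultimately show "finite (L - V)"
      by (rule finite_subset[rotated])
  qed
qed

section \<open>The two implications\<close>

text \<open>\<open>D\<close> is the preimage of \<open>c0 S\<close> under the embedding, and
  \<open>\<kappa>\<close> is the cardinality of the set of nonzero coordinate functions.\<close>

lemma semi_Eberlein_imp_separating_one_point_A:
  fixes K :: "'a topology"
  assumes "semi_Eberlein K"
  obtains D L and \<kappa> :: "('a \<Rightarrow> real) rel"
  where "dense_in K D" "Card_order \<kappa>" "L \<subseteq> C_fun K"
    "subtopology (tau_p K D) L homeomorphic_space one_point_A \<kappa>" "separates_points L K"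
proof -
  obtain S :: "('a \<Rightarrow> real) set" and e
    where emb: "embedding_map K (powertop_real S) e"
      and dens: "dense_in (subtopology (powertop_real S) (e ` topspace K)) (c0 S \<inter> e ` topspace K)"
    using assms by (auto simp: semi_Eberlein_def semi_Eberlein_embedding_def)
  let ?E = "subtopology (powertop_real S) (e ` topspace K)"
  have hom: "homeomorphic_map K ?E e"
    using emb by (simp add: embedding_map_def)
  have conte: "continuous_map K (powertop_real S) e"
    using hom homeomorphic_imp_continuous_map continuous_map_in_subtopology by blast
  have inje: "inj_on e (topspace K)"
    using hom by (rule homeomorphic_imp_injective_map)
  define D where "D = {x \<in> topspace K. e x \<in> c0 S}"
  define \<pi> where "\<pi> s = restrict (\<lambda>x. e x s) (topspace K)" for s
  define z where "z = restrict (\<lambda>x. 0::real) (topspace K)"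
  define L where "L = insert z (\<pi> ` S)"
  have D: "dense_in K D"
  proof -
    have eD: "e ` D = c0 S \<inter> e ` topspace K"
      by (auto simp: D_def)
    have sub: "D \<subseteq> topspace K"
      by (auto simp: D_def)
    \<comment> \<open>A homeomorphism onto the image commutes with closure, so density of the
      \<open>c0\<close> part pulls back to \<open>K\<close>.\<close>
    have "e ` (K closure_of D) = ?E closure_of (e ` D)"
      using homeomorphic_map_closure_of[OF hom sub] by simp
    also have "\<dots> = topspace ?E"
      using dens unfolding eD dense_in_def by blast
    also have "\<dots> = e ` topspace K"
      by (rule homeomorphic_imp_surjective_map[OF hom, symmetric])
    finally have "K closure_of D = topspace K"
      using inje closure_of_subset_topspace[of K D] by (metis inj_on_image_eq_iff order_refl)
    then show ?thesis
      using sub by (simp add: dense_in_def)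
  qed
  have \<pi>: "\<pi> s \<in> C_fun K" if "s \<in> S" for s
    using conte that unfolding continuous_map_componentwise C_fun_def \<pi>_def by auto
  have L: "L \<subseteq> C_fun K"
    using \<pi> by (auto simp: L_def C_fun_def z_def)
  have z: "z \<in> L"
    by (simp add: L_def)
  have "\<forall>d\<in>D. \<forall>\<epsilon>>0. finite {f \<in> L. \<bar>f d - z d\<bar> > \<epsilon>}"
  proof (intro ballI allI impI)
    fix d and \<epsilon> :: real assume d: "d \<in> D" and \<epsilon>: "\<epsilon> > 0"
    then have "finite {s \<in> S. \<bar>e d s\<bar> > \<epsilon>}"
      by (auto simp: D_def c0_def)
    \<comment> \<open>Different indices may give the same coordinate function, but the image of a
      finite set is still finite. The adjoined \<open>z\<close> is not in the left-hand set, since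
      its difference from itself is \<open>0\<close>.\<close>
    moreover have "{f \<in> L. \<bar>f d - z d\<bar> > \<epsilon>} \<subseteq> \<pi> ` {s \<in> S. \<bar>e d s\<bar> > \<epsilon>}"
      using d \<epsilon> by (auto simp: L_def D_def z_def \<pi>_def)
    ultimately show "finite {f \<in> L. \<bar>f d - z d\<bar> > \<epsilon>}"
      using finite_surj by blast
  qed
  then have cofin: "\<forall>V. openin (subtopology (tau_p K D) L) V \<and> z \<in> V \<longrightarrow> finite (L - V)"
    using tau_p_cofinite_iff[OF L z] by blast
  have top: "topspace (subtopology (tau_p K D) L) = L"
    using L by (simp add: Int_absorb1)
  have "subtopology (tau_p K D) L homeomorphic_space
      one_point_A (card_of (topspace (subtopology (tau_p K D) L) - {z}))"
    using cofin z D
    by (intro homeomorphic_space_one_point_A Hausdorff_space_subtopology Hausdorff_space_tau_p)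
      (simp_all add: top del: topspace_subtopology)
  moreover have "separates_points L K"
    unfolding separates_points_def
  proof (intro ballI impI)
    fix x y assume xy: "x \<in> topspace K" "y \<in> topspace K" "x \<noteq> y"
    then have "e x \<noteq> e y"
      using inje by (auto dest: inj_onD)
    moreover have "e x \<in> extensional S" "e y \<in> extensional S"
      using conte xy by (auto simp: continuous_map_componentwise)
    ultimately obtain s where "s \<in> S" "e x s \<noteq> e y s"
      by (meson extensionalityI)
    then show "\<exists>f\<in>L. f x \<noteq> f y"
      using xy by (intro bexI[of _ "\<pi> s"]) (auto simp: \<pi>_def L_def)
  qed
  ultimately show thesis
    using that D L card_of_Card_order by blast
qed

text \<open>The index set is \<open>L\<close> itself, whose elements already have the index type
  fixed in \<open>semi_Eberlein\<close>.\<close>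

lemma separating_one_point_A_imp_semi_Eberlein:
  fixes K :: "'a topology"
  assumes K: "compact_space K" and D: "dense_in K D" and L: "L \<subseteq> C_fun K"
    and hom: "subtopology (tau_p K D) L homeomorphic_space one_point_A \<kappa>"
    and sep: "separates_points L K"
  shows "semi_Eberlein K"
proof -
  have top: "topspace (subtopology (tau_p K D) L) = L"
    using L by (simp add: Int_absorb1)
  obtain p where p: "p \<in> L"
    and cofin: "\<And>V. openin (subtopology (tau_p K D) L) V \<Longrightarrow> p \<in> V \<Longrightarrow> finite (L - V)"
    using homeomorphic_one_point_A_imp_cofinite[OF hom] unfolding top by blast
  have fin: "finite {f \<in> L. \<bar>f d - p d\<bar> > \<epsilon>}" if "d \<in> D" "\<epsilon> > 0" for d \<epsilon>
    using tau_p_cofinite_iff[OF L p] cofin that by blast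
  define e where "e x = restrict (\<lambda>f. if f = p then p x else f x - p x) L" for x
  have contf: "continuous_map K euclideanreal f" if "f \<in> L" for f
    using L that by (auto simp: C_fun_def)
  have conte: "continuous_map K (powertop_real L) e"
    unfolding continuous_map_componentwise
  proof (intro conjI ballI)
    fix f assume f: "f \<in> L"
    have "continuous_map K euclideanreal (\<lambda>x. f x - p x)"
      using contf f p by (intro continuous_map_diff)
    then show "continuous_map K euclideanreal (\<lambda>x. e x f)"
      using contf[OF p] f by (cases "f = p") (simp_all add: e_def)
  qed (auto simp: e_def)
  have inje: "inj_on e (topspace K)"
  proof (rule inj_onI)
    fix x y assume xy: "x \<in> topspace K" "y \<in> topspace K" and eq: "e x = e y"
    \<comment> \<open>The coordinate \<open>p\<close> is compared first; adding
      \<open>p x = p y\<close> back to the other coordinates then recovers the values of every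
      \<open>f\<close>.\<close>
    have px: "p x = p y"
      using fun_cong[OF eq, of p] p by (simp add: e_def)
    have "f x = f y" if "f \<in> L" for f
      using fun_cong[OF eq, of f] that px by (cases "f = p") (simp_all add: e_def)
    then show "x = y"
      using sep xy unfolding separates_points_def by blast
  qed
  have "Hausdorff_space (powertop_real L)"
    by (simp add: Hausdorff_space_product_topology)
  \<comment> \<open>Compactness of \<open>K\<close> enters here: it turns a continuous injection
    into a Hausdorff space into an embedding.\<close>
  then have "closed_map K (powertop_real L) e"
    using K conte by (intro continuous_imp_closed_map_gen) (auto simp: Hausdorff_imp_kc_space)
  then have emb: "embedding_map K (powertop_real L) e"
    using conte inje injective_closed_imp_embedding_map by blast
  have sub: "e ` topspace K \<subseteq> topspace (powertop_real L)"
    using conte continuous_map_image_subset_topspace by blast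
  have c0: "e d \<in> c0 L" if d: "d \<in> D" for d
  proof -
    have "finite {f \<in> L. \<bar>e d f\<bar> > \<epsilon>}" if "\<epsilon> > 0" for \<epsilon>
    proof (rule finite_subset)
      \<comment> \<open>The exceptional coordinate \<open>p\<close> carries the value
        \<open>p d\<close>, which may exceed \<open>\<epsilon>\<close> in absolute value, so it is
        added by hand.\<close>
      show "{f \<in> L. \<bar>e d f\<bar> > \<epsilon>} \<subseteq> insert p {f \<in> L. \<bar>f d - p d\<bar> > \<epsilon>}"
        by (auto simp: e_def)
      show "finite (insert p {f \<in> L. \<bar>f d - p d\<bar> > \<epsilon>})"
        using fin d that by simp
    qed
    then show ?thesis
      by (auto simp: c0_def e_def)
  qed
  let ?C = "c0 L \<inter> e ` topspace K"
  have "e ` topspace K = e ` (K closure_of D)"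
    using D by (simp add: dense_in_def)
  \<comment> \<open>Continuity carries density of \<open>D\<close> over to its image, which lies in
    \<open>c0 L\<close>.\<close>
  also have "\<dots> \<subseteq> powertop_real L closure_of (e ` D)"
    using conte by (rule continuous_map_image_closure_subset)
  also have "\<dots> \<subseteq> powertop_real L closure_of ?C"
    using c0 D by (intro closure_of_mono) (auto simp: dense_in_def)
  finally have "subtopology (powertop_real L) (e ` topspace K) closure_of ?C = e ` topspace K"
    by (subst closure_of_subtopology) (auto simp: Int_absorb1)
  then have "dense_in (subtopology (powertop_real L) (e ` topspace K)) ?C"
    using sub by (auto simp: dense_in_def)
  then show ?thesis
    using K emb unfolding semi_Eberlein_def semi_Eberlein_embedding_def by blast
qed

theorem proposition3p2:
  fixes K :: "'a topology"
  assumes "compact_space K" and "Hausdorff_space K"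
  shows "semi_Eberlein K \<longleftrightarrow>
    (\<exists>D (\<kappa> :: ('a \<Rightarrow> real) rel) L.
       dense_in K D \<and> Card_order \<kappa> \<and> L \<subseteq> C_fun K \<and>
       subtopology (tau_p K D) L homeomorphic_space one_point_A \<kappa> \<and>
       separates_points L K)"
proof
  assume "semi_Eberlein K"
  then show "\<exists>D (\<kappa> :: ('a \<Rightarrow> real) rel) L.
       dense_in K D \<and> Card_order \<kappa> \<and> L \<subseteq> C_fun K \<and>
       subtopology (tau_p K D) L homeomorphic_space one_point_A \<kappa> \<and>
       separates_points L K"
    using semi_Eberlein_imp_separating_one_point_A by metis
next
  assume "\<exists>D (\<kappa> :: ('a \<Rightarrow> real) rel) L.
       dense_in K D \<and> Card_order \<kappa> \<and> L \<subseteq> C_fun K \<and>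
       subtopology (tau_p K D) L homeomorphic_space one_point_A \<kappa> \<and>
       separates_points L K"
  then show "semi_Eberlein K"
    using assms(1) separating_one_point_A_imp_semi_Eberlein by blast
qed

end
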